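(* Let $D$ be a characteristic set of $\mathrm{et}(\mathbb{C}^2)$. For every $F\in\mathrm{Aut}(\mathbb{C}^2)$ the mapping $L_F$, $L_F(G)=F\circ G$, is an isometry of the metric space $(\mathrm{et}(\mathbb{C}^2),\rho_D)$.
   Context: $\mathrm{et}(\mathbb{C}^2)$ denotes the set of all polynomial mappings $G=(G_1,G_2)\in\mathbb{C}[X,Y]^2$ such that (1) $\det J_G\equiv 1$, where $J_G$ is the Jacobian matrix of $G$, and (2) $\deg G_1=\deg_Y G_1$ and $\deg G_2=\deg_Y G_2$. With composition $\circ$ as binary operation, $(\mathrm{et}(\mathbb{C}^2),\circ)$ is taken to be a semigroup with unit $\mathrm{id}$; it contains the group $\mathrm{Aut}(\mathbb{C}^2)$ of all invertible polynomial mappings (subject to conditions (1) and (2)). A characteristic set of $\mathrm{et}(\mathbb{C}^2)$ is an open set $D\subseteq\mathbb{C}^2$ (Euclidean topology) with $\mathrm{int}(\overline{D})=D$, $\overline{D}$ compact, and such that for all $F,G\in\mathrm{et}(\mathbb{C}^2)$, $F(D)=G(D)\Leftrightarrow F=G$. For such $D$, $\rho_D(F,G)$ is the Euclidean volume (in $\mathbb{C}^2\cong\mathbb{R}^4$) of the symmetric difference $F(D)\Delta G(D)$; it is a metric on $\mathrm{et}(\mathbb{C}^2)$.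
   Formalization: As defined, et(C²) is not closed under composition: F=(Y,Y−X), G=(X+Y,Y) give F∘G=(Y,−X), violating (2). So L_F is shown to preserve ρ_D for all pairs in et(C²) and to be a bijection of all maps with det J = 1, not a self-map of et(C²). *)

theory Defs
  imports "HOL-Analysis.Analysis" "HOL-Computational_Algebra.Polynomial"
begin

text \<open>
  C[X,Y] is represented as \<open>(C[X])[Y]\<close>: for \<open>P :: complex poly poly\<close> the coefficient of
  \<open>X^i Y^j\<close> is \<open>coeff (coeff P j) i\<close>. Hence \<open>degree P\<close> is the degree in \<open>Y\<close>.
\<close>

type_synonym bipoly = "complex poly poly"
type_synonym polymap = "bipoly \<times> bipoly"

definition pX :: bipoly where "pX = [:[:0, 1:]:]"

definition pY :: bipoly where "pY = [:0, 1:]"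

definition total_degree :: "bipoly \<Rightarrow> nat" where
  "total_degree P = Max (insert 0 {i + j | i j. coeff (coeff P j) i \<noteq> 0})"

definition dX :: "bipoly \<Rightarrow> bipoly" where "dX P = map_poly pderiv P"

definition dY :: "bipoly \<Rightarrow> bipoly" where "dY P = pderiv P"

definition jacobian_matrix :: "polymap \<Rightarrow> bipoly ^ 2 ^ 2" where
  "jacobian_matrix G =
     vector [vector [dX (fst G), dY (fst G)],
             vector [dX (snd G), dY (snd G)]]"

definition eval_map :: "polymap \<Rightarrow> complex \<times> complex \<Rightarrow> complex \<times> complex" where
  "eval_map G = (\<lambda>(x, y). (poly (poly (fst G) [:y:]) x, poly (poly (snd G) [:y:]) x))"

text \<open>\<open>subst2 P U V\<close> is \<open>P(U, V)\<close>, i.e. \<open>U\<close> is substituted for \<open>X\<close> and \<open>V\<close> for \<open>Y\<close>.\<close>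

definition subst2 :: "bipoly \<Rightarrow> bipoly \<Rightarrow> bipoly \<Rightarrow> bipoly" where
  "subst2 P U V = poly (map_poly (\<lambda>q. poly (map_poly (\<lambda>a. [:[:a:]:]) q) U) P) V"

definition id_map :: polymap where "id_map = (pX, pY)"

definition comp_map :: "polymap \<Rightarrow> polymap \<Rightarrow> polymap" where
  "comp_map F G = (subst2 (fst F) (fst G) (snd G), subst2 (snd F) (fst G) (snd G))"

definition jac1 :: "polymap set" where
  "jac1 = {G. det (jacobian_matrix G) = 1}"

definition et :: "polymap set" where
  "et = {G \<in> jac1. total_degree (fst G) = degree (fst G) \<and>
                   total_degree (snd G) = degree (snd G)}"

definition Aut_et :: "polymap set" where
  "Aut_et = {F \<in> et. \<exists>H. comp_map F H = id_map \<and> comp_map H F = id_map}"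

definition left_mult :: "polymap \<Rightarrow> polymap \<Rightarrow> polymap" where
  "left_mult F = (\<lambda>G. comp_map F G)"

definition characteristic_set :: "(complex \<times> complex) set \<Rightarrow> bool" where
  "characteristic_set D \<longleftrightarrow>
     open D \<and> interior (closure D) = D \<and> compact (closure D) \<and>
     (\<forall>F\<in>et. \<forall>G\<in>et. eval_map F ` D = eval_map G ` D \<longleftrightarrow> F = G)"

text \<open>
  \<open>complex \<times> complex\<close> carries the Euclidean structure of real 4-space, and
  \<open>lebesgue\<close> is the four-dimensional Lebesgue measure on it.
\<close>

definition rho :: "(complex \<times> complex) set \<Rightarrow> polymap \<Rightarrow> polymap \<Rightarrow> real" where
  "rho D F G = measure lebesgue (sym_diff (eval_map F ` D) (eval_map G ` D))"

lemma subst2_eval: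
  "poly (poly (subst2 P U V) [:y:]) x =
     poly (poly P [:poly (poly V [:y:]) x:]) (poly (poly U [:y:]) x)"
proof -
  have inner: "poly (poly (poly (map_poly (\<lambda>a. [:[:a:]:]) q) U) [:y:]) x
      = poly q (poly (poly U [:y:]) x)" for q :: "complex poly"
    by (induction q) (simp_all add: map_poly_pCons)
  show ?thesis
    unfolding subst2_def
    by (induction P) (simp_all add: map_poly_pCons inner)
qed

lemma eval_comp_map: "eval_map (comp_map F G) = eval_map F \<circ> eval_map G"
  by (auto simp: eval_map_def comp_map_def subst2_eval)

lemma eval_id_map: "eval_map id_map = id"
  by (auto simp: eval_map_def id_map_def pX_def pY_def)

lemma coeff_pCons_pCons_nonzero:
  fixes a b c :: complex
  shows "{i + j | i j. coeff (coeff [:[:a, b:], [:c:]:] j) i \<noteq> 0} =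
    (if a = 0 then {} else {0}) \<union> (if b = 0 then {} else {1}) \<union> (if c = 0 then {} else {1})"
proof -
  have "coeff (coeff [:[:a, b:], [:c:]:] j) i =
      (if j = 0 \<and> i = 0 then a else if j = 0 \<and> i = 1 then b
       else if j = 1 \<and> i = 0 then c else 0)" for i j
    by (auto simp: coeff_pCons split: nat.splits)
  then show ?thesis by auto
qed

lemma total_degree_linear:
  fixes a b c :: complex
  shows "total_degree [:[:a, b:], [:c:]:] = (if b = 0 \<and> c = 0 then 0 else 1)"
  unfolding total_degree_def coeff_pCons_pCons_nonzero by auto

text \<open>
  The degree condition is not stable under composition, and the identity violates it: with
  \<open>F = (Y, Y - X)\<close> and \<open>G = (X + Y, Y)\<close> one gets \<open>F \<circ> G = (Y, -X)\<close>. So a left multiplication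
  by an element of \<open>Aut_et\<close> is in general not a self-map of \<open>et\<close>; its natural codomain is
  \<open>jac1\<close>.
\<close>

lemma id_map_not_in_et: "id_map \<notin> et"
  using total_degree_linear[of 0 1 0] by (simp add: et_def id_map_def pX_def)

lemma et_not_closed: "\<exists>F\<in>Aut_et. \<exists>G\<in>et. left_mult F G \<notin> et"
proof -
  define F :: polymap where "F = ([:[:0, 0:], [:1:]:], [:[:0, -1:], [:1:]:])"
  define H :: polymap where "H = ([:[:0, 1:], [:-1:]:], [:[:0, 1:], [:0:]:])"
  define G :: polymap where "G = ([:[:0, 1:], [:1:]:], [:[:0, 0:], [:1:]:])"
  have F: "F \<in> et"
    unfolding et_def jac1_def
    by (simp only: F_def fst_conv snd_conv mem_Collect_eq total_degree_linear)
       (simp add: det_2 jacobian_matrix_def dX_def dY_def map_poly_pCons pderiv_pCons one_pCons)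
  have G: "G \<in> et"
    unfolding et_def jac1_def
    by (simp only: G_def fst_conv snd_conv mem_Collect_eq total_degree_linear)
       (simp add: det_2 jacobian_matrix_def dX_def dY_def map_poly_pCons pderiv_pCons one_pCons)
  have "comp_map F H = id_map" "comp_map H F = id_map"
    by (simp_all add: comp_map_def F_def H_def id_map_def subst2_def pX_def pY_def
        map_poly_pCons one_pCons)
  with F have "F \<in> Aut_et" unfolding Aut_et_def by blast
  moreover have "left_mult F G = (pY, [:[:0, -1:], [:0:]:])"
    by (simp add: left_mult_def comp_map_def F_def G_def subst2_def pY_def
        map_poly_pCons one_pCons)
  then have "left_mult F G \<notin> et"
    using total_degree_linear[of 0 "-1" 0] by (simp add: et_def)
  ultimately show ?thesis using G by blast
qed

end

theory Submission
  imports Defs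
begin

text \<open>
  Let \<open>K\<close> be the polynomial inverse of \<open>F\<close>. Both halves of the theorem rest on the derivative of a
  polynomial map being the linear map given by its formal Jacobian matrix
  (\<open>eval_map_has_derivative\<close>).

  \<^item> Bijectivity on \<open>jac1\<close>. A polynomial over the complex numbers is determined by its values, so
    identities between polynomial maps may be checked after evaluation: composition is associative,
    and the analytic chain rule makes Jacobian determinants multiplicative
    (\<open>det_jacobian_comp_map\<close>). Hence \<open>jac1\<close> is closed under composition, and
    \<open>K\<close> belongs to it, because \<open>F \<circ> K\<close> is the identity. So \<open>left_mult K\<close> maps \<open>jac1\<close> into itself
    and inverts \<open>left_mult F\<close>.

  \<^item> Isometry. As \<open>F\<close> is injective, it maps the symmetric difference of \<open>G(D)\<close> and \<open>H(D)\<close> onto that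
    of \<open>F(G(D))\<close> and \<open>F(H(D))\<close>, so it suffices that \<open>F\<close> preserves volume. The real
    determinant of a complex linear map is the squared modulus of its complex determinant
    (\<open>det_matrix_complex_linear\<close>), which is 1 here, and the change of variables formula applies.
    That formula concerns maps of \<open>real^4\<close>; it is carried over to pairs of complex numbers
    by the coordinate isomorphism \<open>to_R4\<close>, which preserves Lebesgue measure (\<open>lborel_to_R4\<close>).
    Measurability causes no difficulty: \<open>D\<close> is open, hence a countable union of compact sets,
    and so is its image under a continuous map.
\<close>

section \<open>Polynomials as functions of two complex variables\<close>

definition eval2 :: "bipoly \<Rightarrow> complex \<times> complex \<Rightarrow> complex" where
  "eval2 P p = poly (poly P [:snd p:]) (fst p)"

lemma eval2_simps [simp]:
  "eval2 0 p = 0" "eval2 1 p = 1"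
  "eval2 (P + Q) p = eval2 P p + eval2 Q p"
  "eval2 (P - Q) p = eval2 P p - eval2 Q p"
  "eval2 (P * Q) p = eval2 P p * eval2 Q p"
  "eval2 (pCons q P) p = poly q (fst p) + snd p * eval2 P p"
  by (simp_all add: eval2_def)

lemma eval_map_eq_eval2: "eval_map G p = (eval2 (fst G) p, eval2 (snd G) p)"
  by (simp add: eval_map_def eval2_def case_prod_beta)

text \<open>
  Viewed as a polynomial in \<open>Y\<close> over \<open>C[X]\<close>, the difference of \<open>P\<close> and \<open>Q\<close> has all
  the infinitely many constants \<open>[:y:]\<close> as roots.
\<close>

lemma eval2_inject:
  assumes "\<And>p. eval2 P p = eval2 Q p"
  shows "P = Q"
proof (rule ccontr)
  assume "P \<noteq> Q"
  have "poly (poly (P - Q) [:y:]) x = 0" for x y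
    using assms[of "(x, y)"] by (simp add: eval2_def)
  then have "poly (P - Q) [:y:] = 0" for y
    using poly_all_0_iff_0 by blast
  then have "range (\<lambda>y::complex. [:y:]) \<subseteq> {q. poly (P - Q) q = 0}"
    by blast
  moreover have "finite {q. poly (P - Q) q = 0}"
    using \<open>P \<noteq> Q\<close> by (intro poly_roots_finite) simp
  ultimately have "finite (range (\<lambda>y::complex. [:y:]))"
    using finite_subset by blast
  moreover have "inj (\<lambda>y::complex. [:y:])"
    by (simp add: inj_def)
  ultimately show False
    using finite_imageD infinite_UNIV_char_0 by blast
qed

lemma eval_map_inject: "eval_map F = eval_map G \<Longrightarrow> F = G"
  by (metis eval_map_eq_eval2 eval2_inject prod.inject prod_eq_iff)

lemma comp_map_assoc: "comp_map (comp_map F G) H = comp_map F (comp_map G H)"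
  by (rule eval_map_inject) (simp add: eval_comp_map comp_assoc)

lemma comp_id_map: "comp_map id_map G = G"
  by (rule eval_map_inject) (simp add: eval_comp_map eval_id_map)

section \<open>Jacobians and the chain rule\<close>

lemma dX_0: "dX 0 = 0"
  by (simp add: dX_def)

lemma dX_pCons: "dX (pCons q P) = pCons (pderiv q) (dX P)"
  by (simp add: dX_def map_poly_pCons)

text \<open>
  Induction on the \<open>Y\<close>-coefficients, by the Horner step \<open>q(X) + Y P(X, Y)\<close>.
\<close>

lemma eval2_has_derivative:
  "(eval2 P has_derivative (\<lambda>v. eval2 (dX P) p * fst v + eval2 (dY P) p * snd v)) (at p)"
proof (induction P)
  case 0
  have "eval2 0 = (\<lambda>_. 0)" by (simp add: fun_eq_iff)
  then show ?case by (simp add: dX_0 dY_def)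
next
  case (pCons q P)
  have e: "eval2 (pCons q P) = (\<lambda>p. poly q (fst p) + snd p * eval2 P p)"
    by (simp add: fun_eq_iff)
  have q: "((\<lambda>p. poly q (fst p)) has_derivative (\<lambda>v. poly (pderiv q) (fst p) * fst v)) (at p)"
    using has_derivative_compose[OF has_derivative_fst[OF has_derivative_ident]
        poly_DERIV[of q "fst p", unfolded has_field_derivative_def]]
    by simp
  show ?case
    unfolding e
    by (rule has_derivative_eq_rhs, rule has_derivative_add[OF q],
        rule has_derivative_mult[OF has_derivative_snd[OF has_derivative_ident] pCons.IH])
      (simp add: fun_eq_iff dX_pCons dY_def pderiv_pCons algebra_simps)
qed

definition jacobian :: "polymap \<Rightarrow> complex \<times> complex \<Rightarrow> complex \<times> complex \<Rightarrow> complex \<times> complex" where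
  "jacobian G p v =
     (eval2 (dX (fst G)) p * fst v + eval2 (dY (fst G)) p * snd v,
      eval2 (dX (snd G)) p * fst v + eval2 (dY (snd G)) p * snd v)"

lemma eval_map_has_derivative: "(eval_map G has_derivative jacobian G p) (at p)"
  unfolding jacobian_def eval_map_eq_eval2[abs_def]
  by (intro has_derivative_Pair eval2_has_derivative)

lemma eval2_det_jacobian_matrix:
  "eval2 (det (jacobian_matrix G)) p =
     eval2 (dX (fst G)) p * eval2 (dY (snd G)) p - eval2 (dY (fst G)) p * eval2 (dX (snd G)) p"
  by (simp add: det_2 jacobian_matrix_def)

lemma jacobian_comp_map: "jacobian (comp_map F G) p = jacobian F (eval_map G p) \<circ> jacobian G p"
proof -
  have "(eval_map (comp_map F G) has_derivative jacobian F (eval_map G p) \<circ> jacobian G p) (at p)"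
    unfolding eval_comp_map by (intro diff_chain_at eval_map_has_derivative)
  then show ?thesis
    using eval_map_has_derivative has_derivative_unique by blast
qed

text \<open>
  The values of the derivatives at the two unit vectors are the columns of the
  Jacobian matrices, so the chain rule becomes a product of matrices.
\<close>

lemma det_jacobian_comp_map:
  "eval2 (det (jacobian_matrix (comp_map F G))) p =
     eval2 (det (jacobian_matrix F)) (eval_map G p) * eval2 (det (jacobian_matrix G)) p"
  using fun_cong[OF jacobian_comp_map[of F G p], of "(1, 0)"]
    fun_cong[OF jacobian_comp_map[of F G p], of "(0, 1)"]
  unfolding eval2_det_jacobian_matrix jacobian_def
  by (simp add: algebra_simps)

lemma jac1_iff: "G \<in> jac1 \<longleftrightarrow> (\<forall>p. eval2 (det (jacobian_matrix G)) p = 1)"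
  unfolding jac1_def by (auto intro: eval2_inject)

lemma comp_map_in_jac1: "F \<in> jac1 \<Longrightarrow> G \<in> jac1 \<Longrightarrow> comp_map F G \<in> jac1"
  by (simp add: jac1_iff det_jacobian_comp_map del: split_paired_All)

lemma id_map_in_jac1: "id_map \<in> jac1"
  by (simp add: jac1_iff eval2_det_jacobian_matrix id_map_def pX_def pY_def dX_def dY_def
      map_poly_pCons pderiv_pCons)

text \<open>
  By the chain rule the two determinants multiply to 1, the first factor being 1 already.
\<close>

lemma right_inverse_in_jac1: "F \<in> jac1 \<Longrightarrow> comp_map F H = id_map \<Longrightarrow> H \<in> jac1"
  using id_map_in_jac1 det_jacobian_comp_map[of F H]
  by (simp add: jac1_iff del: split_paired_All)

lemma left_mult_bij_betw_jac1:
  assumes F: "F \<in> jac1" and FH: "comp_map F H = id_map" and HF: "comp_map H F = id_map"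
  shows "bij_betw (left_mult F) jac1 jac1"
proof (rule bij_betw_byWitness)
  have "H \<in> jac1" using F FH by (rule right_inverse_in_jac1)
  with F show "left_mult F ` jac1 \<subseteq> jac1" "left_mult H ` jac1 \<subseteq> jac1"
    by (auto simp: left_mult_def comp_map_in_jac1)
qed (simp_all add: left_mult_def FH HF comp_id_map flip: comp_map_assoc)

section \<open>Pairs of complex numbers as real 4-space\<close>

definition to_R4 :: "complex \<times> complex \<Rightarrow> real^4" where
  "to_R4 p = vector [Re (fst p), Im (fst p), Re (snd p), Im (snd p)]"

definition of_R4 :: "real^4 \<Rightarrow> complex \<times> complex" where
  "of_R4 v = (Complex (v $ 1) (v $ 2), Complex (v $ 3) (v $ 4))"

lemma vector_4 [simp]:
  "(vector [x,y,z,w] :: 'a::zero^4) $ 1 = x"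
  "(vector [x,y,z,w] :: 'a::zero^4) $ 2 = y"
  "(vector [x,y,z,w] :: 'a::zero^4) $ 3 = z"
  "(vector [x,y,z,w] :: 'a::zero^4) $ 4 = w"
  unfolding vector_def by simp_all

lemma of_R4_to_R4 [simp]: "of_R4 (to_R4 p) = p"
  by (simp add: of_R4_def to_R4_def)

lemma to_R4_of_R4 [simp]: "to_R4 (of_R4 v) = v"
  by (simp add: of_R4_def to_R4_def vec_eq_iff forall_4)

lemma linear_to_R4: "linear to_R4"
  by (rule linearI) (simp_all add: to_R4_def vec_eq_iff forall_4)

lemma linear_of_R4: "linear of_R4"
  by (rule linearI) (simp_all add: of_R4_def complex_eq_iff)

lemma image_to_R4: "to_R4 ` A = of_R4 -` A"
proof (intro set_eqI iffI)
  fix v assume "v \<in> of_R4 -` A"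
  then have "to_R4 (of_R4 v) \<in> to_R4 ` A" by blast
  then show "v \<in> to_R4 ` A" by simp
qed auto

lemma prod_4: "prod f (UNIV :: 4 set) = f 1 * f 2 * f 3 * f 4"
  unfolding UNIV_4 by (simp add: ac_simps)

lemma prod_Basis_complex_prod:
  "prod f (Basis :: (complex \<times> complex) set) = f (1, 0) * f (\<i>, 0) * f (0, 1) * f (0, \<i>)"
proof -
  have B: "(Basis :: (complex \<times> complex) set) = {(0, 1), (0, \<i>), (1, 0), (\<i>, 0)}"
    by (simp add: Basis_prod_def Basis_complex_def)
  show ?thesis
    unfolding B by (simp add: ac_simps)
qed

text \<open>
  Lebesgue measure is characterised by the volumes of boxes, and the coordinate map takes boxes to
  boxes with the same side lengths.
\<close>

lemma lborel_to_R4: "distr lborel lborel to_R4 = (lborel :: (real^4) measure)"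
proof (rule lborel_eqI[symmetric])
  have [measurable]: "to_R4 \<in> borel_measurable borel"
    by (intro borel_measurable_continuous_onI linear_continuous_on linear_conv_bounded_linear[THEN iffD1] linear_to_R4)
  fix l u :: "real^4"
  assume le: "\<And>b. b \<in> Basis \<Longrightarrow> l \<bullet> b \<le> u \<bullet> b"
  have bv: "to_R4 -` box l u = box (of_R4 l) (of_R4 u)"
    by (auto simp: mem_box Basis_prod_def Basis_complex_def of_R4_def to_R4_def inner_axis Basis_vec_def forall_4)
  have le': "l $ i \<le> u $ i" for i
    using le[of "axis i 1"] by (simp add: inner_axis axis_in_Basis_iff)
  have "emeasure (distr lborel lborel to_R4) (box l u) = emeasure lborel (box (of_R4 l) (of_R4 u))"
    by (simp add: emeasure_distr bv)
  also have "\<dots> = (\<Prod>b\<in>Basis. (of_R4 u - of_R4 l) \<bullet> b)"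
    using le' by (intro emeasure_lborel_box) (auto simp: Basis_prod_def Basis_complex_def of_R4_def)
  also have "(\<Prod>b\<in>Basis. (of_R4 u - of_R4 l) \<bullet> b) = (\<Prod>i\<in>UNIV. u $ i - l $ i)"
    unfolding prod_Basis_complex_prod prod_4 by (simp add: of_R4_def)
  also have "\<dots> = (\<Prod>b\<in>Basis. (u - l) \<bullet> b)"
  proof -
    have B: "(Basis :: (real^4) set) = (\<lambda>i. axis i 1) ` UNIV"
      by (auto simp: Basis_vec_def)
    show ?thesis
      unfolding B by (simp add: prod.reindex inj_on_def axis_eq_axis inner_axis)
  qed
  finally show "emeasure (distr lborel lborel to_R4) (box l u) = (\<Prod>b\<in>Basis. (u - l) \<bullet> b)" .
qed simp

text \<open>
  Laplace expansion along the first two rows: each minor of these rows is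
  multiplied by the complementary minor of the last two rows.
\<close>

lemma det_4:
  "det (A::'a::comm_ring_1^4^4) =
     (A$1$1 * A$2$2 - A$1$2 * A$2$1) * (A$3$3 * A$4$4 - A$3$4 * A$4$3)
   - (A$1$1 * A$2$3 - A$1$3 * A$2$1) * (A$3$2 * A$4$4 - A$3$4 * A$4$2)
   + (A$1$1 * A$2$4 - A$1$4 * A$2$1) * (A$3$2 * A$4$3 - A$3$3 * A$4$2)
   + (A$1$2 * A$2$3 - A$1$3 * A$2$2) * (A$3$1 * A$4$4 - A$3$4 * A$4$1)
   - (A$1$2 * A$2$4 - A$1$4 * A$2$2) * (A$3$1 * A$4$3 - A$3$3 * A$4$1)
   + (A$1$3 * A$2$4 - A$1$4 * A$2$3) * (A$3$1 * A$4$2 - A$3$2 * A$4$1)"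
proof -
  have f1: "finite {2::4, 3, 4}" "1 \<notin> {2::4, 3, 4}" by auto
  have f2: "finite {3::4, 4}" "2 \<notin> {3::4, 4}" by auto
  have f3: "finite {4::4}" "3 \<notin> {4::4}" by auto
  show ?thesis
    unfolding det_def UNIV_4
    unfolding sum_over_permutations_insert[OF f1]
    unfolding sum_over_permutations_insert[OF f2]
    unfolding sum_over_permutations_insert[OF f3]
    unfolding permutes_sing
    by (simp add: sign_swap_id permutation_swap_id permutation_compose sign_compose transpose_def algebra_simps)
qed

text \<open>
  In real coordinates every complex entry \<open>z\<close> becomes the block with rows \<open>(Re z, - Im z)\<close> and
  \<open>(Im z, Re z)\<close>; the determinant of the resulting matrix factors as the sum of the squares of the
  real and imaginary parts of \<open>a * d - b * c\<close>.
\<close>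

lemma det_matrix_complex_linear:
  "det (matrix (\<lambda>v. to_R4 (a * fst (of_R4 v) + b * snd (of_R4 v),
                            c * fst (of_R4 v) + d * snd (of_R4 v)))) =
     (cmod (a * d - b * c))\<^sup>2"
  (is "det ?M = _")
proof -
  have M:
    "?M$1$1 = Re a" "?M$1$2 = - Im a" "?M$1$3 = Re b" "?M$1$4 = - Im b"
    "?M$2$1 = Im a" "?M$2$2 = Re a" "?M$2$3 = Im b" "?M$2$4 = Re b"
    "?M$3$1 = Re c" "?M$3$2 = - Im c" "?M$3$3 = Re d" "?M$3$4 = - Im d"
    "?M$4$1 = Im c" "?M$4$2 = Re c" "?M$4$3 = Im d" "?M$4$4 = Re d"
    by (simp_all add: matrix_def to_R4_def of_R4_def axis_def)
  show ?thesis
    unfolding det_4 M cmod_power2 by simp algebra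
qed

section \<open>Volume preservation\<close>

lemma measure_lebesgue_to_R4:
  assumes "A \<in> sets borel"
  shows "measure lebesgue (to_R4 ` A) = measure lebesgue A"
proof -
  have m: "to_R4 \<in> borel_measurable borel" "of_R4 \<in> borel_measurable borel"
    by (intro borel_measurable_continuous_onI linear_continuous_on
        linear_conv_bounded_linear[THEN iffD1] linear_to_R4 linear_of_R4)+
  have B: "to_R4 ` A \<in> sets borel"
    using measurable_sets[OF m(2) assms] by (simp add: image_to_R4)
  have "measure lebesgue (to_R4 ` A) = measure (distr lborel lborel to_R4) (to_R4 ` A)"
    using B by (simp only: lborel_to_R4 measure_completion sets_lborel)
  also have "\<dots> = measure lborel (to_R4 -` to_R4 ` A)"
    using B m by (subst measure_distr) simp_all
  also have "to_R4 -` to_R4 ` A = A"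
    by (intro inj_vimage_image_eq inj_on_inverseI[of _ of_R4]) simp
  also have "measure lborel A = measure lebesgue A"
    using assms by (simp only: measure_completion sets_lborel)
  finally show ?thesis .
qed

text \<open>
  Conjugating \<open>f\<close> by the coordinate isomorphism gives a map of real 4-space whose Jacobian
  determinant has absolute value 1, so the change of variables formula integrates the constant 1.
  Boundedness of \<open>A\<close> makes that constant integrable.
\<close>

lemma measure_image_unimodular_complex_derivative:
  fixes f :: "complex \<times> complex \<Rightarrow> complex \<times> complex"
  assumes A: "A \<in> sets borel" "bounded A" and fA: "f ` A \<in> sets borel" and inj: "inj_on f A"
    and der: "\<And>p. p \<in> A \<Longrightarrow>
      (f has_derivative (\<lambda>v. (a p * fst v + b p * snd v, c p * fst v + d p * snd v))) (at p)"
    and unimodular: "\<And>p. p \<in> A \<Longrightarrow> cmod (a p * d p - b p * c p) = 1"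
  shows "measure lebesgue (f ` A) = measure lebesgue A"
proof -
  define L where "L p v = (a p * fst v + b p * snd v, c p * fst v + d p * snd v)" for p v
  define g where "g = to_R4 \<circ> f \<circ> of_R4"
  define g' where "g' x = (\<lambda>v. to_R4 (L (of_R4 x) (of_R4 v)))" for x
  let ?B = "to_R4 ` A"
  have bl: "bounded_linear to_R4" "bounded_linear of_R4"
    using linear_to_R4 linear_of_R4 by (simp_all add: linear_conv_bounded_linear)
  have "of_R4 \<in> borel_measurable borel"
    by (intro borel_measurable_continuous_onI linear_continuous_on bl)
  then have B: "?B \<in> sets borel"
    using measurable_sets[of of_R4 borel borel A] A by (simp add: image_to_R4)
  have "bounded ?B"
    using A bl by (intro bounded_linear_image)
  then have Bl: "?B \<in> lmeasurable"
    using B by (intro bounded_set_imp_lmeasurable) auto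
  have img: "g ` ?B = to_R4 ` f ` A"
    by (simp add: g_def image_image)
  have det1: "\<bar>det (matrix (g' x))\<bar> = 1" if "x \<in> ?B" for x
    using that unimodular unfolding g'_def L_def
    by (auto simp: det_matrix_complex_linear)
  have derg: "(g has_derivative g' x) (at x within ?B)" if "x \<in> ?B" for x
  proof -
    have "(f has_derivative L (of_R4 x)) (at (of_R4 x))"
      using that der unfolding L_def by auto
    then have "(g has_derivative (to_R4 \<circ> (L (of_R4 x) \<circ> of_R4))) (at x)"
      unfolding g_def o_assoc[symmetric]
      by (intro diff_chain_at bounded_linear_imp_has_derivative bl)
    then show ?thesis
      by (simp add: g'_def comp_def has_derivative_at_withinI)
  qed
  have injg: "inj_on g ?B"
    using inj unfolding g_def inj_on_def by (auto dest!: arg_cong[where f = of_R4])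
  have "measure lebesgue (f ` A) = measure lebesgue (g ` ?B)"
    unfolding img using fA by (rule measure_lebesgue_to_R4[symmetric])
  also have "\<dots> = integral ?B (\<lambda>x. \<bar>det (matrix (g' x))\<bar>)"
  proof (rule measure_differentiable_image_eq[OF _ derg injg])
    show "?B \<in> sets lebesgue" using Bl by blast
    have "(\<lambda>x. 1::real) integrable_on ?B"
      using Bl lmeasurable_iff_integrable_on by blast
    then show "(\<lambda>x. \<bar>det (matrix (g' x))\<bar>) integrable_on ?B"
      by (rule integrable_eq) (simp add: det1)
  qed
  also have "\<dots> = integral ?B (\<lambda>x. 1)"
    by (intro Henstock_Kurzweil_Integration.integral_cong det1)
  also have "\<dots> = measure lebesgue ?B"
    using Bl by (simp add: lmeasure_integral)
  also have "\<dots> = measure lebesgue A"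
    using A(1) by (rule measure_lebesgue_to_R4)
  finally show ?thesis .
qed

lemma continuous_on_eval_map: "continuous_on S (eval_map G)"
  by (intro continuous_at_imp_continuous_on ballI has_derivative_continuous[OF eval_map_has_derivative])

text \<open>
  Continuous images of Borel sets need not be Borel, but an open set is a countable union of
  compact sets, and their images are compact.
\<close>

lemma continuous_image_open_borel:
  fixes f :: "'a::euclidean_space \<Rightarrow> 'b::t2_space"
  assumes "continuous_on D f" and "open D"
  shows "f ` D \<in> sets borel"
proof -
  obtain C where C: "\<And>n. compact (C n)" "\<And>n. C n \<subseteq> D" "D = (\<Union>n::nat. C n)"
    using open_Union_compact_subsets[OF \<open>open D\<close>] by metis
  have "closed (f ` C n)" for n
    using C assms by (intro compact_imp_closed compact_continuous_image) (auto intro: continuous_on_subset)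
  then have "(\<Union>n. f ` C n) \<in> sets borel"
    by (intro sets.countable_UN image_subsetI borel_closed)
  also have "(\<Union>n. f ` C n) = f ` D"
    unfolding C(3) by (rule image_UN[symmetric])
  finally show ?thesis .
qed

text \<open>
  Here the image of a Borel set is Borel because it is the preimage under the continuous
  inverse \<open>H\<close>.
\<close>

lemma measure_eval_map_image:
  assumes F: "F \<in> jac1" and FH: "comp_map F H = id_map" and HF: "comp_map H F = id_map"
    and A: "A \<in> sets borel" "bounded A"
  shows "measure lebesgue (eval_map F ` A) = measure lebesgue A"
proof (rule measure_image_unimodular_complex_derivative[OF A])
  have inv: "eval_map F (eval_map H p) = p" "eval_map H (eval_map F p) = p" for p
    by (metis FH HF comp_apply eval_comp_map eval_id_map id_apply)+
  show "inj_on (eval_map F) A"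
    using inv(2) by (rule inj_on_inverseI)
  have "eval_map F ` A = eval_map H -` A"
  proof (intro set_eqI iffI)
    fix q assume "q \<in> eval_map H -` A"
    then have "eval_map F (eval_map H q) \<in> eval_map F ` A" by blast
    then show "q \<in> eval_map F ` A" by (simp add: inv)
  qed (auto simp: inv)
  moreover have "eval_map H \<in> borel_measurable borel"
    by (intro borel_measurable_continuous_onI continuous_on_eval_map)
  ultimately show "eval_map F ` A \<in> sets borel"
    using measurable_sets[of "eval_map H" borel borel A] A by simp
next
  fix p
  show "(eval_map F has_derivative (\<lambda>v.
      (eval2 (dX (fst F)) p * fst v + eval2 (dY (fst F)) p * snd v,
       eval2 (dX (snd F)) p * fst v + eval2 (dY (snd F)) p * snd v))) (at p)"
    using eval_map_has_derivative[of F p] unfolding jacobian_def .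
  show "cmod (eval2 (dX (fst F)) p * eval2 (dY (snd F)) p
      - eval2 (dY (fst F)) p * eval2 (dX (snd F)) p) = 1"
    using F by (metis eval2_det_jacobian_matrix jac1_iff norm_one)
qed

theorem proposition8p1:
  fixes D :: "(complex \<times> complex) set" and F :: polymap
  assumes "characteristic_set D"
    and "F \<in> Aut_et"
  shows "bij_betw (left_mult F) jac1 jac1 \<and>
    (\<forall>G\<in>et. \<forall>H\<in>et. rho D (left_mult F G) (left_mult F H) = rho D G H)"
proof (intro conjI ballI)
  obtain K where FK: "comp_map F K = id_map" and KF: "comp_map K F = id_map" and F: "F \<in> jac1"
    using assms(2) unfolding Aut_et_def et_def by blast
  show "bij_betw (left_mult F) jac1 jac1"
    using F FK KF by (rule left_mult_bij_betw_jac1)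
  have D: "open D" "compact (closure D)"
    using assms(1) unfolding characteristic_set_def by blast+
  have borel: "eval_map G ` D \<in> sets borel" for G
    using D(1) by (intro continuous_image_open_borel continuous_on_eval_map)
  have bounded: "bounded (eval_map G ` D)" for G
  proof (rule bounded_subset)
    show "bounded (eval_map G ` closure D)"
      using D(2) by (intro compact_imp_bounded compact_continuous_image continuous_on_eval_map)
  qed (use closure_subset in blast)
  have "eval_map K \<circ> eval_map F = id"
    by (simp add: KF eval_id_map flip: eval_comp_map)
  then have inj: "inj (eval_map F)"
    by (metis inj_on_id inj_on_imageI2[of "eval_map K"])
  fix G H
  let ?S = "sym_diff (eval_map G ` D) (eval_map H ` D)"
  have "rho D (left_mult F G) (left_mult F H) = measure lebesgue (eval_map F ` ?S)"
    by (simp add: rho_def left_mult_def eval_comp_map image_image image_Un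
        image_set_diff[OF inj])
  also have "\<dots> = measure lebesgue ?S"
  proof (rule measure_eval_map_image[OF F FK KF])
    show "?S \<in> sets borel" by (intro sets.Un sets.Diff borel)
    show "bounded ?S" by (auto intro: bounded_subset[OF bounded])
  qed
  also have "\<dots> = rho D G H"
    by (simp add: rho_def)
  finally show "rho D (left_mult F G) (left_mult F H) = rho D G H" .
qed

end
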